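(* Let $n\ge2$, $c>0$, $p,q\in\mathbb{R}^n$ and $\omega\in\mathbb{S}^{n-1}$. Let $$p'=p+a\,\omega,\qquad q'=q-a\,\omega,\qquad a=\frac{2(p^0+q^0)\{\omega\cdot(p^0q-q^0p)\}}{(p^0+q^0)^2-(\omega\cdot[p+q])^2}.$$ Then the post-collisional energies $p'^0=\sqrt{c^2+|p'|^2}$ and $q'^0=\sqrt{c^2+|q'|^2}$ are given by $$p'^0=p^0+N^0,\qquad q'^0=q^0-N^0,\qquad N^0=\frac{2\,\omega\cdot(p+q)\,\{\omega\cdot(p^0q-q^0p)\}}{(p^0+q^0)^2-(\omega\cdot[p+q])^2}.$$
   Context: For $p\in\mathbb{R}^n$ the energy is $p^0=\sqrt{c^2+|p|^2}$, and similarly $q^0=\sqrt{c^2+|q|^2}$. *)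

theory Defs
  imports "HOL-Analysis.Analysis"
begin

definition energy :: "real \<Rightarrow> real ^ 'n \<Rightarrow> real" where
  "energy c p = sqrt (c\<^sup>2 + (norm p)\<^sup>2)"

end

theory Submission
  imports Defs
begin

text \<open>
  Only the energies and the components along \<open>\<omega>\<close> change in the collision, so the problem
  lives in the Minkowski plane with points \<open>(E, P) = (p\<^sup>0, \<omega> \<bullet> p)\<close> and
  \<open>(F, Q) = (q\<^sup>0, \<omega> \<bullet> q)\<close>. With the total momentum \<open>(S, T) = (E + F, P + Q)\<close>, the map
  adds to \<open>(E, P)\<close> and subtracts from \<open>(F, Q)\<close> the same multiple of the vector \<open>(T, S)\<close>, which
  is Minkowski-orthogonal to \<open>(S, T)\<close>: it is the reflection that fixes \<open>(S, T)\<close>. In the light-cone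
  coordinates \<open>E + P\<close> and \<open>E - P\<close> this reflection is an exchange of the two coordinates
  followed by a positive rescaling \<open>(S + T) / (S - T)\<close> of one and its inverse of the other
  (lemma \<open>lightcone_swap\<close>). Hence the product \<open>E\<^sup>2 - P\<^sup>2\<close> is
  preserved, which gives the mass-shell relation for the new pair, and both coordinates stay
  positive. The positivity is needed in addition to the mass-shell relation: it excludes the
  negative root, so that \<open>E + N\<^sup>0\<close> really is the energy.

  Interchanging \<open>p\<close> and \<open>q\<close> changes the sign of both \<open>a\<close> and \<open>N\<^sup>0\<close>, so the
  statement for \<open>q'\<close> is the one for \<open>p'\<close> with the roles reversed.
\<close>

lemma energy_squared: "(energy c p)\<^sup>2 = c\<^sup>2 + (norm p)\<^sup>2"
  by (simp add: energy_def)

text \<open>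
  Strictness comes from the rest mass \<open>c > 0\<close>. It puts \<open>(E, P)\<close> inside the light cone, so
  that all light-cone coordinates, and with them the denominator of the collision map, are positive.
\<close>
lemma abs_component_less_energy:
  assumes "c > 0" and "norm \<omega> = 1"
  shows "\<bar>\<omega> \<bullet> p\<bar> < energy c p"
proof -
  have "\<bar>\<omega> \<bullet> p\<bar> \<le> norm p"
    using Cauchy_Schwarz_ineq2[of \<omega> p] assms(2) by simp
  also have "norm p < energy c p"
    unfolding energy_def using assms(1) by (intro real_less_rsqrt) simp
  finally show ?thesis .
qed

text \<open>
  With \<open>u = E + P\<close>, \<open>v = E - P\<close>, \<open>w = F + Q\<close>, \<open>z = F - Q\<close> one has
  \<open>S + T = u + w\<close>, \<open>S - T = v + z\<close> and \<open>2 (E Q - F P) = v w - u z\<close>. The denominator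
  \<open>S\<^sup>2 - T\<^sup>2\<close> factors as \<open>(S + T) (S - T)\<close> and one factor cancels against the sum or
  difference of \<open>N\<close> and \<open>a\<close>. The new coordinate \<open>u + (v w - u z) / (v + z)\<close> then
  equals \<open>v (u + w) / (v + z)\<close>; the other one is similar.
\<close>
lemma lightcone_swap:
  fixes E F P Q :: real
  defines "S \<equiv> E + F" and "T \<equiv> P + Q"
  defines "a \<equiv> 2 * S * (E * Q - F * P) / (S\<^sup>2 - T\<^sup>2)"
    and "N \<equiv> 2 * T * (E * Q - F * P) / (S\<^sup>2 - T\<^sup>2)"
  assumes pos: "S + T > 0" "S - T > 0"
  shows "(E + N) + (P + a) = (E - P) * ((S + T) / (S - T))"
    and "(E + N) - (P + a) = (E + P) * ((S - T) / (S + T))"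
proof -
  have D: "S\<^sup>2 - T\<^sup>2 = (S + T) * (S - T)"
    by (simp add: power2_eq_square algebra_simps)
  have "N + a = 2 * (E * Q - F * P) * (S + T) / ((S + T) * (S - T))"
    unfolding N_def a_def D by (simp add: add_divide_distrib[symmetric] algebra_simps)
  then have sum: "N + a = 2 * (E * Q - F * P) / (S - T)"
    using pos by simp
  have "N - a = - (2 * (E * Q - F * P)) * (S - T) / ((S + T) * (S - T))"
    unfolding N_def a_def D by (simp add: diff_divide_distrib[symmetric] algebra_simps)
  then have diff: "N - a = - (2 * (E * Q - F * P)) / (S + T)"
    using pos by simp
  have "(E + P) * (S - T) + 2 * (E * Q - F * P) = (E - P) * (S + T)"
    unfolding S_def T_def by (simp add: algebra_simps)
  then have "(E + P) + (N + a) = (E - P) * ((S + T) / (S - T))"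
    unfolding sum using pos by (simp add: field_simps)
  then show "(E + N) + (P + a) = (E - P) * ((S + T) / (S - T))"
    by (simp add: algebra_simps)
  have "(E - P) * (S + T) - 2 * (E * Q - F * P) = (E + P) * (S - T)"
    unfolding S_def T_def by (simp add: algebra_simps)
  then have "(E - P) + (N - a) = (E + P) * ((S - T) / (S + T))"
    unfolding diff using pos by (simp add: field_simps)
  then show "(E + N) - (P + a) = (E + P) * ((S - T) / (S + T))"
    by (simp add: algebra_simps)
qed

lemma norm_add_scaleR_unit:
  fixes p \<omega> :: "'a::real_inner"
  assumes "norm \<omega> = 1"
  shows "(norm (p + a *\<^sub>R \<omega>))\<^sup>2 = (norm p)\<^sup>2 + (\<omega> \<bullet> p + a)\<^sup>2 - (\<omega> \<bullet> p)\<^sup>2"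
proof -
  have "\<omega> \<bullet> \<omega> = 1"
    using assms by (simp add: dot_square_norm)
  then show ?thesis
    unfolding power2_norm_eq_inner
    by (simp add: inner_simps inner_commute power2_eq_square algebra_simps)
qed

lemma energy_after_collision:
  fixes c :: real and p q \<omega> :: "real ^ 'n"
  defines "K \<equiv> \<omega> \<bullet> (energy c p *\<^sub>R q - energy c q *\<^sub>R p)"
    and "D \<equiv> (energy c p + energy c q)\<^sup>2 - (\<omega> \<bullet> (p + q))\<^sup>2"
  assumes c: "c > 0" and unit: "norm \<omega> = 1"
  shows "energy c (p + (2 * (energy c p + energy c q) * K / D) *\<^sub>R \<omega>)
           = energy c p + 2 * (\<omega> \<bullet> (p + q)) * K / D"
proof -
  define E F P Q where "E = energy c p" and "F = energy c q" and "P = \<omega> \<bullet> p" and "Q = \<omega> \<bullet> q"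
  define S T where "S = E + F" and "T = P + Q"
  define a N where "a = 2 * S * (E * Q - F * P) / (S\<^sup>2 - T\<^sup>2)"
    and "N = 2 * T * (E * Q - F * P) / (S\<^sup>2 - T\<^sup>2)"
  have KD: "K = E * Q - F * P" "D = S\<^sup>2 - T\<^sup>2" "\<omega> \<bullet> (p + q) = T"
    by (simp_all add: K_def D_def E_def F_def P_def Q_def S_def T_def inner_simps)
  have "\<bar>P\<bar> < E" "\<bar>Q\<bar> < F"
    unfolding E_def F_def P_def Q_def using abs_component_less_energy[OF c unit] by auto
  then have pos: "S + T > 0" "S - T > 0" "E + P > 0" "E - P > 0"
    unfolding S_def T_def by linarith+
  note swap = lightcone_swap[of E F P Q, folded S_def T_def, folded a_def N_def, OF pos(1,2)]
  have "(E + N) + (P + a) > 0" "(E + N) - (P + a) > 0"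
    unfolding swap using pos by simp_all
  then have nonneg: "E + N \<ge> 0"
    by linarith
  have "(E + N)\<^sup>2 - (P + a)\<^sup>2 = ((E + N) + (P + a)) * ((E + N) - (P + a))"
    by (simp add: power2_eq_square algebra_simps)
  also have "\<dots> = (E - P) * (E + P)"
    unfolding swap using pos by simp
  also have "\<dots> = E\<^sup>2 - P\<^sup>2"
    by (simp add: power2_eq_square algebra_simps)
  also have "E\<^sup>2 = c\<^sup>2 + (norm p)\<^sup>2"
    unfolding E_def by (rule energy_squared)
  finally have "c\<^sup>2 + (norm (p + a *\<^sub>R \<omega>))\<^sup>2 = (E + N)\<^sup>2"
    unfolding norm_add_scaleR_unit[OF unit] P_def by simp
  then have "energy c (p + a *\<^sub>R \<omega>) = E + N"
    unfolding energy_def using nonneg by simp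
  then show ?thesis
    unfolding KD a_def N_def S_def E_def F_def .
qed

theorem mainTheorem5:
  fixes c a N0 :: real
    and p q p' q' \<omega> :: "real ^ 'n"
  assumes "CARD('n) \<ge> 2"
    and "c > 0"
    and "\<omega> \<in> sphere 0 1"
    and "a = 2 * (energy c p + energy c q) * (\<omega> \<bullet> (energy c p *\<^sub>R q - energy c q *\<^sub>R p))
             / ((energy c p + energy c q)\<^sup>2 - (\<omega> \<bullet> (p + q))\<^sup>2)"
    and "p' = p + a *\<^sub>R \<omega>"
    and "q' = q - a *\<^sub>R \<omega>"
    and "N0 = 2 * (\<omega> \<bullet> (p + q)) * (\<omega> \<bullet> (energy c p *\<^sub>R q - energy c q *\<^sub>R p))
              / ((energy c p + energy c q)\<^sup>2 - (\<omega> \<bullet> (p + q))\<^sup>2)"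
  shows "energy c p' = energy c p + N0 \<and> energy c q' = energy c q - N0"
proof -
  have unit: "norm \<omega> = 1"
    using assms(3) by simp
  have "energy c p' = energy c p + N0"
    unfolding assms(4,5,7) by (rule energy_after_collision[OF assms(2) unit])
  moreover have "energy c q' = energy c q - N0"
  proof -
    have flip: "\<omega> \<bullet> (energy c q *\<^sub>R p - energy c p *\<^sub>R q)
                  = - (\<omega> \<bullet> (energy c p *\<^sub>R q - energy c q *\<^sub>R p))"
      by (simp add: inner_simps)
    show ?thesis
      using energy_after_collision[OF assms(2) unit, of q p]
      unfolding assms(4,6,7) flip by (simp add: add.commute)
  qed
  ultimately show ?thesis ..
qed

end
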